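(* Let $n\ge3$, $l\ge5$ and $0\le\alpha<1$. Let $H$ be a connected linear $3$-graph on $n$ vertices that is Berge-$C_l$-free, let $\mathbf{x}$ be the $\alpha$-Perron vector of $H$, and let $u\in V(H)$ be a vertex whose entry in $\mathbf{x}$ is maximum. Then $$\rho_\alpha^2(H)\le \alpha d_u^2+(1-\alpha)\left[\frac{(2l-7)(n-1)}{4}+(2l-3)d_u\right].$$
   Context: A $k$-graph ($k$-uniform hypergraph) $H$ consists of a finite vertex set $V(H)$ and a set $E(H)$ of $k$-element subsets of $V(H)$ (edges). $H$ is linear if any two distinct edges share at most one vertex. Two vertices are adjacent if some edge contains both; $H$ is connected if the graph on $V(H)$ with this adjacency relation is connected. The degree $d_v$ of a vertex $v$ is the number of edges containing $v$. For $V(H)=\{v_1,\dots,v_n\}$, the adjacency tensor $\mathcal{A}(H)=(a_{i_1\dots i_k})$ is the order-$k$, dimension-$n$ tensor with $a_{i_1\dots i_k}=\frac{1}{(k-1)!}$ if $\{v_{i_1},\dots,v_{i_k}\}\in E(H)$ and $0$ otherwise; $\mathcal{D}(H)$ is the diagonal tensor with entries $d_{i\dots i}=d_{v_i}$ and all other entries $0$. For $0\le\alpha<1$, $\mathcal{A}_\alpha(H)=\alpha\mathcal{D}(H)+(1-\alpha)\mathcal{A}(H)$. A number $\lambda\in\mathbb{C}$ is an eigenvalue of an order-$k$ dimension-$n$ tensor $\mathcal{A}=(a_{i_1\dots i_k})$ if there is a nonzero $\mathbf{x}\in\mathbb{C}^n$ with $\sum_{i_2,\dots,i_k=1}^n a_{i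 i_2\dots i_k}x_{i_2}\cdots x_{i_k}=\lambda x_i^{k-1}$ for all $i$; the spectral radius is the largest modulus of an eigenvalue. $\rho_\alpha(H)$ denotes the spectral radius of $\mathcal{A}_\alpha(H)$. For connected $H$, $\rho_\alpha(H)$ is an eigenvalue of $\mathcal{A}_\alpha(H)$ with an eigenvector having all entries positive, unique up to positive scaling; this is the $\alpha$-Perron vector of $H$. For a graph $G$, a hypergraph $F$ is a Berge-$G$ if there is a bijection $\varphi:E(G)\to E(F)$ with $e\subseteq\varphi(e)$ for every $e\in E(G)$. $H$ is Berge-$G$-free if no subhypergraph of $H$ is a Berge-$G$. $C_l$ denotes the cycle of length $l$. *)

theory Defs
  imports Complex_Main
begin

definition k_graph :: "nat \<Rightarrow> 'a set \<Rightarrow> 'a set set \<Rightarrow> bool" where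
  "k_graph k V E \<longleftrightarrow> finite V \<and> (\<forall>e\<in>E. e \<subseteq> V \<and> card e = k)"

definition linear_hypergraph :: "'a set set \<Rightarrow> bool" where
  "linear_hypergraph E \<longleftrightarrow> (\<forall>e\<in>E. \<forall>f\<in>E. e \<noteq> f \<longrightarrow> card (e \<inter> f) \<le> 1)"

definition hadjacent :: "'a set set \<Rightarrow> 'a \<Rightarrow> 'a \<Rightarrow> bool" where
  "hadjacent E u v \<longleftrightarrow> (\<exists>e\<in>E. u \<in> e \<and> v \<in> e)"

definition hconnected :: "'a set \<Rightarrow> 'a set set \<Rightarrow> bool" where
  "hconnected V E \<longleftrightarrow> V \<noteq> {} \<and> (\<forall>u\<in>V. \<forall>v\<in>V. (hadjacent E)\<^sup>*\<^sup>* u v)"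

definition hdegree :: "'a set set \<Rightarrow> 'a \<Rightarrow> nat" where
  "hdegree E v = card {e\<in>E. v \<in> e}"


text \<open>
  An order-\<open>k\<close> tensor with index set \<open>V\<close> is a function on lists; only its values on lists of
  length \<open>k\<close> with entries in \<open>V\<close> are relevant. The vertices themselves serve as indices, so no
  enumeration \<open>v\<^sub>1, \<dots>, v\<^sub>n\<close> of \<open>V\<close> has to be fixed.
\<close>

type_synonym 'a tensor = "'a list \<Rightarrow> complex"

definition adjacency_tensor :: "nat \<Rightarrow> 'a set set \<Rightarrow> 'a tensor" where
  "adjacency_tensor k E is = (if set is \<in> E then 1 / fact (k - 1) else 0)"

definition degree_tensor :: "'a set set \<Rightarrow> 'a tensor" where
  "degree_tensor E is = (if \<forall>j\<in>set is. j = hd is then of_nat (hdegree E (hd is)) else 0)"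

definition A_alpha :: "real \<Rightarrow> nat \<Rightarrow> 'a set set \<Rightarrow> 'a tensor" where
  "A_alpha \<alpha> k E is =
     of_real \<alpha> * degree_tensor E is + of_real (1 - \<alpha>) * adjacency_tensor k E is"

definition tensor_eigenpair ::
    "'a set \<Rightarrow> nat \<Rightarrow> 'a tensor \<Rightarrow> complex \<Rightarrow> ('a \<Rightarrow> complex) \<Rightarrow> bool" where
  "tensor_eigenpair V k T \<mu> x \<longleftrightarrow>
     (\<exists>i\<in>V. x i \<noteq> 0) \<and>
     (\<forall>i\<in>V. (\<Sum>is | set is \<subseteq> V \<and> length is = k - 1. T (i # is) * prod_list (map x is))
             = \<mu> * x i ^ (k - 1))"

definition tensor_eigenvalue :: "'a set \<Rightarrow> nat \<Rightarrow> 'a tensor \<Rightarrow> complex \<Rightarrow> bool" where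
  "tensor_eigenvalue V k T \<mu> \<longleftrightarrow> (\<exists>x. tensor_eigenpair V k T \<mu> x)"

text \<open>
  A tensor of order \<open>k \<ge> 2\<close> on a finite nonempty index set has a nonempty finite set of eigenvalues (the roots of
  its characteristic polynomial), so the supremum is the largest modulus of an eigenvalue.
\<close>

definition tensor_spectral_radius :: "'a set \<Rightarrow> nat \<Rightarrow> 'a tensor \<Rightarrow> real" where
  "tensor_spectral_radius V k T = Sup (cmod ` {\<mu>. tensor_eigenvalue V k T \<mu>})"

definition rho_alpha :: "real \<Rightarrow> nat \<Rightarrow> 'a set \<Rightarrow> 'a set set \<Rightarrow> real" where
  "rho_alpha \<alpha> k V E = tensor_spectral_radius V k (A_alpha \<alpha> k E)"

definition alpha_Perron_vector ::
    "real \<Rightarrow> nat \<Rightarrow> 'a set \<Rightarrow> 'a set set \<Rightarrow> ('a \<Rightarrow> real) \<Rightarrow> bool" where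
  "alpha_Perron_vector \<alpha> k V E x \<longleftrightarrow>
     (\<forall>v\<in>V. 0 < x v) \<and>
     tensor_eigenpair V k (A_alpha \<alpha> k E)
       (complex_of_real (rho_alpha \<alpha> k V E)) (\<lambda>v. complex_of_real (x v))"


definition subhypergraph :: "'a set \<Rightarrow> 'a set set \<Rightarrow> 'a set \<Rightarrow> 'a set set \<Rightarrow> bool" where
  "subhypergraph V' E' V E \<longleftrightarrow> V' \<subseteq> V \<and> E' \<subseteq> E \<and> (\<forall>e\<in>E'. e \<subseteq> V')"

text \<open>Here the edges of \<open>G\<close> and \<open>F\<close> are sets of vertices of the same type.\<close>

definition is_Berge :: "'a set set \<Rightarrow> 'a set set \<Rightarrow> bool" where
  "is_Berge EG EF \<longleftrightarrow> (\<exists>\<phi>. bij_betw \<phi> EG EF \<and> (\<forall>e\<in>EG. e \<subseteq> \<phi> e))"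

text \<open>
  \<open>G\<close> is meant up to isomorphism: the injection \<open>f\<close> ranges over all copies of \<open>G\<close> on
  vertices of the host hypergraph.
\<close>

definition Berge_free :: "'b set \<Rightarrow> 'b set set \<Rightarrow> 'a set \<Rightarrow> 'a set set \<Rightarrow> bool" where
  "Berge_free VG EG V E \<longleftrightarrow>
     \<not> (\<exists>V' E' f. subhypergraph V' E' V E \<and> inj_on f VG \<and> f ` VG \<subseteq> V' \<and>
          is_Berge ((\<lambda>e. f ` e) ` EG) E')"

definition cycle_edges :: "nat \<Rightarrow> nat set set" where
  "cycle_edges l = {{i, Suc i mod l} | i. i < l}"

end

theory Submission
  imports Defs
begin

text \<open>
  Let \<open>N\<close> be the set of neighbours of \<open>u\<close> and \<open>W\<close> the set of the remaining vertices other than \<open>u\<close>.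
  Since \<open>x u\<close> is maximal, the eigenvalue equation at a vertex \<open>v\<close> gives \<open>\<rho> (x v)\<^sup>2 \<le> d v (x u)\<^sup>2\<close>.
  Multiplying the equation at \<open>u\<close> by \<open>\<rho>\<close> and applying AM-GM to each edge at \<open>u\<close>
  yields \<open>\<rho>\<^sup>2 \<le> \<alpha> (d u)\<^sup>2 + (1 - \<alpha>)/2 \<cdot> (\<Sum>v\<in>N. d v)\<close>, so the degree sum over \<open>N\<close> remains to be bounded.

  Count the edges avoiding \<open>u\<close> by the number of their vertices in \<open>N\<close>. If there are too many of them with at
  least two vertices in \<open>N\<close>, or too many with exactly one, then a subhypergraph of large minimum degree
  exists, in which some vertex \<open>a\<close> also has at least the average degree. A Berge path is grown greedily
  from \<open>a\<close> until it has \<open>l - 2\<close> vertices and ends in \<open>N\<close>; the excess degree of \<open>a\<close> leaves a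
  fresh neighbour \<open>y\<close> of \<open>a\<close> in \<open>N\<close>, and \<open>y\<close> and the end of the path are joined through \<open>u\<close>
  to a Berge cycle of length \<open>l\<close>. Edges with one vertex in \<open>N\<close> make the path alternate between \<open>N\<close> and \<open>W\<close>;
  for odd \<open>l\<close> its parity is corrected by a first step from \<open>a\<close> inside \<open>W\<close>.
\<close>

section \<open>Berge paths and Berge cycles\<close>

text \<open>An edge may contain path vertices other than its two consecutive ones. Paths grow by
  consing, so the moving end is \<open>hd zs\<close> and the starting vertex stays at
  \<open>last zs\<close>.\<close>

definition Berge_path :: "'a set set \<Rightarrow> 'a list \<Rightarrow> 'a set list \<Rightarrow> bool" where
  "Berge_path F zs es \<longleftrightarrow> distinct zs \<and> distinct es \<and> length zs = Suc (length es) \<and> set es \<subseteq> F \<and>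
     (\<forall>i<length es. zs ! i \<in> es ! i \<and> zs ! Suc i \<in> es ! i)"

definition nbrs :: "'a set set \<Rightarrow> 'a set \<Rightarrow> 'a \<Rightarrow> 'a set" where
  "nbrs F S v = {y\<in>S. y \<noteq> v \<and> (\<exists>f\<in>F. v \<in> f \<and> y \<in> f)}"

lemma Berge_path_single: "Berge_path F [z] []"
  by (simp add: Berge_path_def)

lemma Berge_path_mono: "Berge_path F zs es \<Longrightarrow> F \<subseteq> G \<Longrightarrow> Berge_path G zs es"
  by (auto simp: Berge_path_def)

lemma Berge_path_nonempty: "Berge_path F zs es \<Longrightarrow> zs \<noteq> []"
  by (auto simp: Berge_path_def)

lemma card_path_minus:
  assumes "z \<in> set zs"
  shows "card (set zs \<inter> S - {z}) \<le> length zs - 1"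
proof -
  have "card (set zs \<inter> S - {z}) \<le> card (set zs - {z})" by (intro card_mono) auto
  also have "\<dots> = card (set zs) - 1" using assms by simp
  also have "\<dots> \<le> length zs - 1" using card_length[of zs] by simp
  finally show ?thesis .
qed

lemma Berge_path_Cons:
  assumes "Berge_path F zs es" "y \<notin> set zs" "f \<in> F" "f \<notin> set es" "hd zs \<in> f" "y \<in> f"
  shows "Berge_path F (y # zs) (f # es)"
proof -
  have "zs ! 0 \<in> f" using assms(5) Berge_path_nonempty[OF assms(1)] by (simp add: hd_conv_nth)
  then show ?thesis
    using assms by (auto simp: Berge_path_def nth_Cons split: nat.splits)
qed

lemma Berge_path_rev:
  assumes "Berge_path F zs es"
  shows "Berge_path F (rev zs) (rev es)"
proof -
  have len: "length zs = Suc (length es)" using assms by (simp add: Berge_path_def)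
  have "rev zs ! i \<in> rev es ! i \<and> rev zs ! Suc i \<in> rev es ! i" if "i < length es" for i
  proof -
    define j where "j = length es - Suc i"
    have j: "j < length es" "rev es ! i = es ! j" "rev zs ! i = zs ! Suc j" "rev zs ! Suc i = zs ! j"
      using that len by (auto simp: j_def rev_nth Suc_diff_Suc)
    then show ?thesis using assms by (auto simp: Berge_path_def)
  qed
  then show ?thesis using assms by (auto simp: Berge_path_def)
qed

text \<open>A path edge other than the first contains two consecutive path vertices different from
  the head. Together with the head these are three distinct vertices, hence the whole edge.\<close>

lemma Berge_path_edge_through_hd:
  assumes "Berge_path F zs es" "f \<in> set es" "f \<noteq> hd es" "hd zs \<in> f" "card f = 3"
  shows "f \<subseteq> set zs"
proof -
  have len: "length zs = Suc (length es)" and dz: "distinct zs"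
    using assms(1) by (auto simp: Berge_path_def)
  obtain j where j: "j < length es" "f = es ! j" using assms(2) by (metis in_set_conv_nth)
  have "j \<noteq> 0" using assms(2,3) j by (metis hd_conv_nth empty_iff list.set(1))
  have h: "hd zs = zs ! 0" using len by (metis hd_conv_nth list.size(3) nat.distinct(1))
  let ?T = "{zs ! 0, zs ! j, zs ! Suc j}"
  have "?T \<subseteq> f" using assms(1,4) j h by (auto simp: Berge_path_def)
  moreover have "card ?T = 3"
    using dz len j(1) \<open>j \<noteq> 0\<close> by (simp add: nth_eq_iff_index_eq card_insert_if)
  ultimately have "?T = f"
    using assms(5) by (metis card_subset_eq card.infinite zero_neq_numeral)
  moreover have "?T \<subseteq> set zs" using len j(1) by auto
  ultimately show ?thesis by simp
qed

text \<open>The new vertex must avoid the path, the extra forbidden set \<open>Q\<close>, and one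
  more vertex that accounts for the summand 1. \<open>S\<close> prescribes the side on which the
  path continues.\<close>

lemma Berge_path_extend:
  assumes p: "Berge_path F zs es" and three: "\<And>f. f \<in> F \<Longrightarrow> card f = 3" and "finite Q"
    and c: "card (set zs \<inter> S - {hd zs}) + card Q + 1 < card (nbrs F S (hd zs))"
  obtains y f where "Berge_path F (y # zs) (f # es)" "y \<in> S" "y \<notin> Q"
proof -
  \<comment> \<open>An edge of the path through its head lies inside the path, except possibly the first edge,
    whose third vertex has to be avoided.\<close>
  define R where "R = (if es = [] then {} else hd es - set zs)"
  have R: "finite R \<and> card R \<le> 1"
  proof (cases "es = []")
    case False
    have f: "zs ! 0 \<in> hd es" "zs ! 1 \<in> hd es" "hd es \<in> F" "length zs \<ge> 2" "distinct zs"
      using p False by (auto simp: Berge_path_def hd_conv_nth Suc_le_eq)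
    have fin: "finite (hd es)" using three[OF f(3)] by (metis card.infinite zero_neq_numeral)
    have "zs ! 0 \<noteq> zs ! 1" using f(4,5) by (subst nth_eq_iff_index_eq) auto
    then have "card {zs ! 0, zs ! 1} = 2" by simp
    moreover have "R \<subseteq> hd es - {zs ! 0, zs ! 1}"
    proof -
      have "zs ! 0 \<in> set zs" "zs ! 1 \<in> set zs" using f(4) by (auto intro!: nth_mem)
      then show ?thesis using False by (auto simp: R_def)
    qed
    then have "card R \<le> card (hd es - {zs ! 0, zs ! 1})" using fin by (intro card_mono) auto
    moreover have "card (hd es - {zs ! 0, zs ! 1}) = card (hd es) - card {zs ! 0, zs ! 1}"
      using f by (intro card_Diff_subset) auto
    ultimately show ?thesis using three[OF f(3)] fin by (auto simp: R_def)
  qed (simp add: R_def)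
  let ?B = "(set zs \<inter> S - {hd zs}) \<union> Q \<union> R"
  have "card ?B \<le> card (set zs \<inter> S - {hd zs}) + card Q + card R"
    by (meson add_le_mono card_Un_le le_refl le_trans)
  then have "card ?B < card (nbrs F S (hd zs))" using R c by linarith
  moreover have "finite ?B" using R assms(3) by auto
  ultimately have "\<not> nbrs F S (hd zs) \<subseteq> ?B" by (meson card_mono leD)
  then obtain y where y: "y \<in> nbrs F S (hd zs)" "y \<notin> ?B" by blast
  then obtain f where f: "f \<in> F" "hd zs \<in> f" "y \<in> f" by (auto simp: nbrs_def)
  have ys: "y \<in> S" "y \<notin> set zs" "y \<notin> Q" "y \<notin> R" using y by (auto simp: nbrs_def)
  have "f \<notin> set es"
  proof
    assume fe: "f \<in> set es"
    then have "f \<noteq> hd es" using f ys by (auto simp: R_def split: if_splits)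
    then have "f \<subseteq> set zs" using Berge_path_edge_through_hd[OF p fe] f three by blast
    then show False using f ys by auto
  qed
  then show ?thesis using that Berge_path_Cons[OF p] f ys by blast
qed

lemma Berge_path_step:
  assumes "card (set zs \<inter> S - {hd zs}) + 1 < card (nbrs F S (hd zs))"
    and "Berge_path F zs es" "\<And>f. f \<in> F \<Longrightarrow> card f = 3"
  obtains y f where "Berge_path F (y # zs) (f # es)" "y \<in> S"
  using assms by (auto intro: Berge_path_extend[of F zs es "{}" S])

text \<open>Otherwise each of \<open>i\<close> and \<open>j\<close> would be the successor of the
  other modulo \<open>l\<close>, forcing \<open>l = 2\<close>.\<close>

lemma cycle_edge_inj:
  assumes "3 \<le> l" "i < l" "j < l" "{i, Suc i mod l} = {j, Suc j mod l}"
  shows "i = j"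
proof (rule ccontr)
  assume "i \<noteq> j"
  then have "i = Suc j mod l" "j = Suc i mod l" using assms(4) by (auto simp: doubleton_eq_iff)
  moreover have "Suc k mod l = (if Suc k = l then 0 else Suc k)" if "k < l" for k
    using that by auto
  ultimately show False using assms(1-3) by (auto split: if_splits)
qed

text \<open>The path vertices embed the cycle by \<open>i\<close> to \<open>zs ! i\<close>.
  Appending \<open>e\<close> to the path edges lets it cover the edge from the last index back to
  0.\<close>

lemma Berge_cycle_not_free:
  assumes k: "k_graph k V E" and p: "Berge_path E zs es" and l: "length zs = l" "3 \<le> l"
    and e: "e \<in> E" "e \<notin> set es" "hd zs \<in> e" "last zs \<in> e"
  shows "\<not> Berge_free {..<l} (cycle_edges l) V E"
proof -
  define ee where "ee = es @ [e]"
  define h where "h i = {zs ! i, zs ! (Suc i mod l)}" for i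
  have len: "l = Suc (length es)" and dz: "distinct zs"
    using p l by (auto simp: Berge_path_def)
  have ee: "length ee = l" "distinct ee" "set ee \<subseteq> E"
    using p e len by (auto simp: ee_def Berge_path_def)
  have sub: "h i \<subseteq> ee ! i" if "i < l" for i
  proof (cases "i = length es")
    case True
    have "zs \<noteq> []" using l by auto
    then show ?thesis using True e l(1) len by (auto simp: h_def ee_def hd_conv_nth last_conv_nth)
  next
    case False
    then show ?thesis using that p len by (auto simp: h_def ee_def nth_append Berge_path_def)
  qed
  have injz: "inj_on ((!) zs) {..<l}" using dz l(1) by (simp add: inj_on_nth)
  have him: "h i = (!) zs ` {i, Suc i mod l}" for i by (simp add: h_def)
  have injh: "inj_on h {..<l}"
  proof (rule inj_onI)
    fix i j assume ij: "i \<in> {..<l}" "j \<in> {..<l}" "h i = h j"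
    then have "{i, Suc i mod l} = {j, Suc j mod l}"
      unfolding him using inj_on_image_eq_iff[OF injz, of "{i, Suc i mod l}" "{j, Suc j mod l}"] len
      by auto
    then show "i = j" using cycle_edge_inj l(2) ij by auto
  qed
  have EG: "(\<lambda>e. (!) zs ` e) ` cycle_edges l = h ` {..<l}"
    unfolding cycle_edges_def him by (simp add: setcompr_eq_image image_image lessThan_def)
  \<comment> \<open>Injectivity of \<open>h\<close> makes sending the cycle edge \<open>h i\<close>
    to \<open>ee ! i\<close> well defined.\<close>
  define \<phi> where "\<phi> = (!) ee \<circ> the_inv_into {..<l} h"
  have "bij_betw (the_inv_into {..<l} h) (h ` {..<l}) {..<l}"
    using injh by (intro bij_betw_the_inv_into) (simp add: bij_betw_def)
  moreover have "bij_betw ((!) ee) {..<l} (set ee)" using ee by (intro bij_betw_nth) auto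
  ultimately have "bij_betw \<phi> (h ` {..<l}) (set ee)" unfolding \<phi>_def by (rule bij_betw_trans)
  moreover have "X \<subseteq> \<phi> X" if X: "X \<in> h ` {..<l}" for X
  proof -
    obtain i where i: "i < l" "X = h i" using X by auto
    then have "\<phi> X = ee ! i" by (simp add: \<phi>_def the_inv_into_f_f[OF injh])
    then show ?thesis using sub i by simp
  qed
  ultimately have berge: "is_Berge ((\<lambda>e. (!) zs ` e) ` cycle_edges l) (set ee)"
    unfolding EG is_Berge_def by blast
  have "zs ! i \<in> V" if "i < l" for i
  proof -
    have "ee ! i \<in> E" using ee that nth_mem by blast
    then show ?thesis using sub[OF that] k by (auto simp: h_def k_graph_def)
  qed
  then have "(!) zs ` {..<l} \<subseteq> V" by auto
  moreover have "subhypergraph V (set ee) V E"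
    using ee k by (auto simp: subhypergraph_def k_graph_def)
  ultimately show ?thesis unfolding Berge_free_def using berge injz by blast
qed

section \<open>Subhypergraphs of large minimum degree\<close>

text \<open>Deleting a vertex \<open>v\<close> of weighted degree at most \<open>t v\<close>
  together with its edges lowers the total weight by at most \<open>t v\<close>, so the strict
  excess persists through the induction. Surviving edges lose no vertices. The threshold may depend
  on the vertex, which later separates \<open>N\<close> from \<open>W\<close>, and the excess is
  kept in the conclusion for an averaging argument over \<open>X'\<close>.\<close>

lemma exists_dense_core:
  fixes w :: "'a set \<Rightarrow> real" and t :: "'a \<Rightarrow> real"
  assumes "finite X" "finite F" "sum t X < sum w F"
  obtains F' X' where "F' \<subseteq> F" "X' \<subseteq> X" "sum t X' < sum w F'" "\<And>f. f \<in> F' \<Longrightarrow> f \<inter> X \<subseteq> X'"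
    "\<And>v. v \<in> X' \<Longrightarrow> t v < sum w {f\<in>F'. v \<in> f}"
proof -
  have "\<exists>F' X'. F' \<subseteq> F \<and> X' \<subseteq> X \<and> sum t X' < sum w F' \<and> (\<forall>f\<in>F'. f \<inter> X \<subseteq> X') \<and>
      (\<forall>v\<in>X'. t v < sum w {f\<in>F'. v \<in> f})"
    using assms
  proof (induction X arbitrary: F rule: finite_psubset_induct)
    case (psubset X)
    show ?case
    proof (cases "\<forall>v\<in>X. t v < sum w {f\<in>F. v \<in> f}")
      case True
      then show ?thesis using psubset.prems by (intro exI[of _ F] exI[of _ X]) auto
    next
      case False
      then obtain v where v: "v \<in> X" "sum w {f\<in>F. v \<in> f} \<le> t v" by force
      let ?F = "{f\<in>F. v \<notin> f}"
      have "F = {f\<in>F. v \<in> f} \<union> ?F" by blast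
      then have "sum w F = sum w ({f\<in>F. v \<in> f} \<union> ?F)" by simp
      also have "\<dots> = sum w {f\<in>F. v \<in> f} + sum w ?F"
        using psubset.prems by (intro sum.union_disjoint) auto
      finally have "sum w F = sum w {f\<in>F. v \<in> f} + sum w ?F" .
      moreover have "sum t X = t v + sum t (X - {v})"
        using v psubset.hyps by (simp add: sum.remove)
      ultimately have "sum t (X - {v}) < sum w ?F" using v psubset.prems by linarith
      moreover have "X - {v} \<subset> X" "finite ?F" using v psubset.prems by auto
      ultimately obtain F' X' where "F' \<subseteq> ?F" "X' \<subseteq> X - {v}" "sum t X' < sum w F'"
        "\<forall>f\<in>F'. f \<inter> (X - {v}) \<subseteq> X'" "\<forall>v\<in>X'. t v < sum w {f\<in>F'. v \<in> f}"
        using psubset.IH[of "X - {v}" ?F] by blast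
      then show ?thesis by (intro exI[of _ F'] exI[of _ X']) blast
    qed
  qed
  then show ?thesis using that by metis
qed

lemma sum_weighted_degree:
  fixes w :: "'a set \<Rightarrow> real"
  assumes "finite X" "finite F"
  shows "(\<Sum>v\<in>X. sum w {f\<in>F. v \<in> f}) = (\<Sum>f\<in>F. w f * real (card (f \<inter> X)))"
proof -
  have "(\<Sum>v\<in>X. sum w {f\<in>F. v \<in> f}) = (\<Sum>v\<in>X. \<Sum>f\<in>F. if v \<in> f then w f else 0)"
    using assms by (simp add: sum.inter_filter)
  also have "\<dots> = (\<Sum>f\<in>F. \<Sum>v\<in>X. if v \<in> f then w f else 0)" by (rule sum.swap)
  also have "\<dots> = (\<Sum>f\<in>F. \<Sum>v\<in>{v\<in>X. v \<in> f}. w f)"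
    using assms by (intro sum.cong refl sum.inter_filter[symmetric])
  also have "\<dots> = (\<Sum>f\<in>F. w f * real (card (f \<inter> X)))"
    by (intro sum.cong refl) (simp add: Collect_conj_eq Int_commute)
  finally show ?thesis .
qed

lemma exists_above_average:
  fixes g :: "'a \<Rightarrow> real"
  assumes "c * real (card X) < sum g X"
  obtains v where "v \<in> X" "c < g v"
proof -
  have "\<exists>v\<in>X. c < g v"
  proof (rule ccontr)
    assume "\<not> ?thesis"
    then have "sum g X \<le> real (card X) * c" by (intro sum_bounded_above) force
    then show False using assms by (simp add: mult.commute)
  qed
  then show ?thesis using that by blast
qed

lemma linear_hypergraph_unique_edge:
  assumes "linear_hypergraph E" "finite e" "e \<in> E" "f \<in> E" "x \<in> e" "x \<in> f" "y \<in> e" "y \<in> f" "x \<noteq> y"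
  shows "e = f"
proof (rule ccontr)
  assume "e \<noteq> f"
  then have "card (e \<inter> f) \<le> 1" using assms by (auto simp: linear_hypergraph_def)
  moreover have "card {x, y} \<le> card (e \<inter> f)" using assms by (intro card_mono) auto
  ultimately show False using assms by simp
qed

text \<open>By linearity the edges through \<open>v\<close> are pairwise disjoint outside
  \<open>v\<close>, so no neighbour is counted twice.\<close>

lemma card_nbrs_linear:
  assumes "linear_hypergraph F" "finite F" "\<And>f. f \<in> F \<Longrightarrow> finite f"
  shows "card (nbrs F S v) = (\<Sum>f | f \<in> F \<and> v \<in> f. card (f \<inter> S - {v}))"
proof -
  have "nbrs F S v = (\<Union>f\<in>{f\<in>F. v \<in> f}. f \<inter> S - {v})" by (auto simp: nbrs_def)
  moreover have "card \<dots> = (\<Sum>f | f \<in> F \<and> v \<in> f. card (f \<inter> S - {v}))"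
  proof (intro card_UN_disjoint ballI impI)
    fix e f assume "e \<in> {f\<in>F. v \<in> f}" "f \<in> {f\<in>F. v \<in> f}" "e \<noteq> f"
    then show "(e \<inter> S - {v}) \<inter> (f \<inter> S - {v}) = {}"
      using linear_hypergraph_unique_edge[OF assms(1), of e f v] assms(3) by blast
  qed (use assms in auto)
  ultimately show ?thesis by simp
qed

section \<open>The neighbourhood of a vertex in a Berge-cycle-free linear 3-graph\<close>

locale Berge_cycle_free_linear_3graph =
  fixes V :: "'a set" and E :: "'a set set" and l :: nat and u :: 'a
  assumes three_graph: "k_graph 3 V E" and linear: "linear_hypergraph E"
    and l5: "5 \<le> l" and free: "Berge_free {..<l} (cycle_edges l) V E"
    and uV: "u \<in> V"
begin

definition N :: "'a set" where "N = nbrs E V u"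
definition W :: "'a set" where "W = V - N - {u}"
definition F :: "'a set set" where "F = {f\<in>E. u \<notin> f}"

lemma finV: "finite V" using three_graph by (simp add: k_graph_def)

lemma edge: "f \<in> E \<Longrightarrow> f \<subseteq> V \<and> card f = 3 \<and> finite f"
  using three_graph finV by (auto simp: k_graph_def intro: finite_subset)

lemma finE: "finite E"
  using finV edge by (intro finite_subset[of E "Pow V"]) auto

lemma F_sub: "F \<subseteq> E" and finF: "finite F"
  using finE by (auto simp: F_def)

lemma finN: "finite N" and N_sub: "N \<subseteq> V" and u_notin_N: "u \<notin> N" and finW: "finite W"
  and NW_disjoint: "N \<inter> W = {}"
  using finV by (auto simp: N_def W_def nbrs_def)

lemma card_NW: "card V = 1 + card N + card W"
proof -
  have "V = insert u (N \<union> W)" using uV N_sub by (auto simp: W_def)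
  moreover have "u \<notin> N \<union> W" using u_notin_N by (auto simp: W_def)
  ultimately have "card V = Suc (card (N \<union> W))" using finN finW by (metis card_insert_disjoint finite_Un)
  then show ?thesis using card_Un_disjoint[OF finN finW NW_disjoint] by simp
qed

lemma N_edge: "y \<in> N \<Longrightarrow> \<exists>g\<in>E. u \<in> g \<and> y \<in> g"
  by (auto simp: N_def nbrs_def)

lemma linear_sub: "G \<subseteq> E \<Longrightarrow> linear_hypergraph G"
  using linear by (auto simp: linear_hypergraph_def)

lemma card_nbrs:
  "G \<subseteq> E \<Longrightarrow> card (nbrs G S v) = (\<Sum>f | f \<in> G \<and> v \<in> f. card (f \<inter> S - {v}))"
  using card_nbrs_linear[OF linear_sub, of G] edge finE finite_subset[of G E] by blast

lemma card_nbrs_le: "card (nbrs E V v) \<le> 2 * hdegree E v"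
proof -
  have "card (nbrs E V v) = (\<Sum>f | f \<in> E \<and> v \<in> f. card (f \<inter> V - {v}))"
    by (rule card_nbrs) simp
  also have "\<dots> \<le> (\<Sum>f | f \<in> E \<and> v \<in> f. 2)"
  proof (intro sum_mono)
    fix f assume f: "f \<in> {f. f \<in> E \<and> v \<in> f}"
    then have "card (f \<inter> V - {v}) \<le> card (f - {v})" using edge by (intro card_mono) auto
    then show "card (f \<inter> V - {v}) \<le> 2" using f edge by auto
  qed
  finally show ?thesis by (simp add: hdegree_def)
qed

section \<open>Closing Berge paths through \<open>u\<close>\<close>

text \<open>Putting \<open>u\<close> before the head, via an edge \<open>h\<close> through
  \<open>u\<close> and the head, gives \<open>l\<close> vertices, and \<open>g\<close> closes the
  cycle. The condition that the head is not in \<open>g\<close> ensures that \<open>g\<close> and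
  \<open>h\<close> differ.\<close>

lemma no_Berge_path_between_nbrs:
  assumes p: "Berge_path F zs es" and "length zs = l - 1" "hd zs \<in> N"
    and g: "g \<in> E" "u \<in> g" "last zs \<in> g" "hd zs \<notin> g"
  shows False
proof -
  obtain h where h: "h \<in> E" "u \<in> h" "hd zs \<in> h" using N_edge assms(3) by blast
  have nz: "zs \<noteq> []" by (rule Berge_path_nonempty[OF p])
  have esu: "u \<notin> f" if "f \<in> set es" for f using that p by (auto simp: Berge_path_def F_def)
  have "u \<notin> set zs"
  proof
    assume "u \<in> set zs"
    then obtain i where i: "i < length zs" "zs ! i = u" by (auto simp: in_set_conv_nth)
    \<comment> \<open>Every vertex of a path with at least one edge lies in a path edge, and the
      edges in \<open>F\<close> avoid \<open>u\<close>.\<close>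
    have "\<exists>f\<in>set es. zs ! i \<in> f"
    proof (cases i)
      case 0
      have "0 < length es" using p assms(2) l5 by (auto simp: Berge_path_def)
      then show ?thesis using p 0 by (auto simp: Berge_path_def intro!: bexI[of _ "es ! 0"])
    next
      case (Suc j)
      then show ?thesis using p i by (auto simp: Berge_path_def intro!: bexI[of _ "es ! j"])
    qed
    then show False using esu i by auto
  qed
  then have "Berge_path E (u # zs) (h # es)"
    using Berge_path_Cons[OF Berge_path_mono[OF p F_sub]] h esu by blast
  moreover have "g \<notin> set (h # es)" using g h esu by auto
  ultimately have "\<not> Berge_free {..<l} (cycle_edges l) V E"
    using Berge_cycle_not_free[OF three_graph, of "u # zs" "h # es" l g] g assms(2) l5 nz by simp
  then show False using free by simp
qed

text \<open>Reversing the path allows one more step from its other end, to a vertex \<open>y\<close>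
  of \<open>N\<close> outside the edge \<open>g\<close> that joins \<open>u\<close> to the old head.
  Of the summand 2, one unit pays for the third vertex of \<open>g\<close>, the other for
  \<open>Berge_path_extend\<close>.\<close>

lemma no_closable_Berge_path:
  assumes G: "G \<subseteq> F" and p: "Berge_path G zs es" and len: "length zs = l - 2"
    and hd: "hd zs \<in> N" and S: "S \<subseteq> N"
    and c: "card (set zs \<inter> S - {last zs}) + 2 < card (nbrs G S (last zs))"
  shows False
proof -
  obtain g where g: "g \<in> E" "u \<in> g" "hd zs \<in> g" using N_edge hd by blast
  have nz: "zs \<noteq> []" by (rule Berge_path_nonempty[OF p])
  have "hd zs \<noteq> u" using hd u_notin_N by blast
  then have Q: "card (g - {u, hd zs}) = 1" "finite (g - {u, hd zs})"
    using g edge[OF g(1)] by (auto simp: card_Diff_subset)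
  have three: "card f = 3" if "f \<in> G" for f using that G F_sub edge by blast
  obtain y f where y: "Berge_path G (y # rev zs) (f # rev es)" "y \<in> S" "y \<notin> g - {u, hd zs}"
    using Berge_path_extend[OF Berge_path_rev[OF p] three Q(2), of S] c Q(1) nz
    by (auto simp: hd_rev)
  have "y \<noteq> u" "y \<in> N" using y S u_notin_N by auto
  moreover have "y \<noteq> hd zs" using y(1) nz by (auto simp: Berge_path_def)
  moreover have "length (y # rev zs) = l - 1" using len l5 by simp
  ultimately show False
    using no_Berge_path_between_nbrs[OF Berge_path_mono[OF y(1) G]] g y nz
    by (auto simp: last_rev)
qed

section \<open>The degree sum over the neighbourhood of \<open>u\<close>\<close>

text \<open>Weight each edge by the number \<open>w\<close> of its vertices in \<open>N\<close>. As
  \<open>w \<le> 2 * (w - 1)\<close> for \<open>w \<ge> 2\<close>, weighted degree above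
  \<open>s\<close> forces more than \<open>s / 2\<close> neighbours inside the core, enough to grow
  a path of \<open>l - 2\<close> vertices within \<open>N\<close>.\<close>

lemma sum_inter_N_of_dense_edges:
  "(\<Sum>f | f \<in> F \<and> 2 \<le> card (f \<inter> N). real (card (f \<inter> N))) \<le> (2 * real l - 9 / 2) * card N"
proof (rule ccontr)
  \<comment> \<open>The constant fits the final bound:
    \<open>1 + (2 * l - 9 / 2) + (l - 3) = (l - 7 / 2) + (2 * l - 3)\<close>.\<close>
  define s where "s = 2 * real l - 9 / 2"
  define w :: "'a set \<Rightarrow> real" where "w f = card (f \<inter> N)" for f
  let ?F = "{f\<in>F. 2 \<le> card (f \<inter> N)}"
  assume "\<not> ?thesis"
  then have "(\<Sum>v\<in>N. s) < sum w ?F" by (simp add: s_def w_def mult.commute not_le)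
  then obtain G X where GX: "G \<subseteq> ?F" "X \<subseteq> N" "(\<Sum>v\<in>X. s) < sum w G" "\<And>f. f \<in> G \<Longrightarrow> f \<inter> N \<subseteq> X"
    "\<And>v. v \<in> X \<Longrightarrow> s < sum w {f\<in>G. v \<in> f}"
    using exists_dense_core[of N ?F "\<lambda>_. s" w] finN finF by auto
  have finG: "finite G" and finX: "finite X" and GF: "G \<subseteq> F" and GE: "G \<subseteq> E"
    using GX finF finN F_sub by (auto intro: finite_subset)
  have GX_int: "f \<inter> X = f \<inter> N" if "f \<in> G" for f using that GX by blast
  have nb: "sum w {f\<in>G. v \<in> f} \<le> 2 * real (card (nbrs G X v))" if "v \<in> X" for v
  proof -
    have "w f \<le> 2 * real (card (f \<inter> X - {v}))" if f: "f \<in> G" "v \<in> f" for f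
    proof -
      have "v \<in> f \<inter> N" using f \<open>v \<in> X\<close> GX by auto
      then have "card (f \<inter> N - {v}) = card (f \<inter> N) - 1" using finN by simp
      moreover have "2 \<le> card (f \<inter> N)" using f GX by blast
      ultimately show ?thesis using GX_int[OF f(1)] by (simp add: w_def)
    qed
    then have "sum w {f\<in>G. v \<in> f} \<le> (\<Sum>f | f \<in> G \<and> v \<in> f. 2 * real (card (f \<inter> X - {v})))"
      by (intro sum_mono) auto
    then show ?thesis unfolding card_nbrs[OF GE] by (simp add: sum_distrib_left)
  qed
  \<comment> \<open>The count is an integer above \<open>s / 2 = l - 9 / 4\<close>.\<close>
  have min_deg: "l - 2 \<le> card (nbrs G X v)" if "v \<in> X" for v
  proof -
    have "s < 2 * real (card (nbrs G X v))" using nb[OF that] GX(5)[OF that] by linarith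
    then show ?thesis unfolding s_def using l5 by linarith
  qed
  \<comment> \<open>The weighted degrees sum to the sum of the squared weights, at least twice the
    total weight, so some vertex \<open>a\<close> exceeds \<open>2 * s\<close>. This doubling pays
    for the closing step at \<open>a\<close>.\<close>
  have "2 * s * card X < 2 * sum w G" using GX(3) by (simp add: mult.commute)
  also have "\<dots> \<le> (\<Sum>f\<in>G. w f * real (card (f \<inter> X)))"
    unfolding sum_distrib_left
  proof (intro sum_mono)
    fix f assume f: "f \<in> G"
    then have "2 \<le> w f" "real (card (f \<inter> X)) = w f" using GX GX_int by (auto simp: w_def)
    then show "2 * w f \<le> w f * real (card (f \<inter> X))" by simp
  qed
  also have "\<dots> = (\<Sum>v\<in>X. sum w {f\<in>G. v \<in> f})" using sum_weighted_degree[OF finX finG] by simp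
  finally obtain a where a: "a \<in> X" "2 * s < sum w {f\<in>G. a \<in> f}" by (rule exists_above_average)
  have big: "l \<le> card (nbrs G X a)"
  proof -
    have "2 * s < 2 * real (card (nbrs G X a))" using nb[OF a(1)] a(2) by linarith
    moreover have "real l \<ge> 5" using l5 by simp
    ultimately have "real l \<le> card (nbrs G X a)" by (simp add: s_def)
    then show ?thesis by simp
  qed
  have three: "card f = 3" if "f \<in> G" for f using that GE edge by blast
  have "\<exists>zs es. Berge_path G zs es \<and> length zs = Suc k \<and> last zs = a \<and> hd zs \<in> X" if "Suc k \<le> l - 2" for k
    using that
  proof (induction k)
    case 0
    show ?case using a by (intro exI[of _ "[a]"] exI[of _ "[]"]) (simp add: Berge_path_single)
  next
    case (Suc k)
    then obtain zs es where p: "Berge_path G zs es" "length zs = Suc k" "last zs = a" "hd zs \<in> X"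
      by auto
    have "card (set zs \<inter> X - {hd zs}) \<le> k"
      using card_path_minus[of "hd zs" zs X] p(2) Berge_path_nonempty[OF p(1)] by simp
    then have "card (set zs \<inter> X - {hd zs}) + 1 < card (nbrs G X (hd zs))"
      using min_deg[OF p(4)] Suc.prems by simp
    then obtain y f where "Berge_path G (y # zs) (f # es)" "y \<in> X"
      by (rule Berge_path_step[OF _ p(1) three])
    then show ?case using p Berge_path_nonempty[OF p(1)]
      by (intro exI[of _ "y # zs"] exI[of _ "f # es"]) auto
  qed
  from this[of "l - 3"] obtain zs es where
    p: "Berge_path G zs es" "length zs = l - 2" "last zs = a" "hd zs \<in> X"
    using l5 by (auto simp: Suc_diff_Suc numeral_eq_Suc)
  have "card (set zs \<inter> X - {last zs}) \<le> l - 3"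
    using card_path_minus[of "last zs" zs X] p(2) Berge_path_nonempty[OF p(1)] by simp
  then have "card (set zs \<inter> X - {last zs}) + 2 < card (nbrs G X (last zs))"
    using big l5 p(3) by simp
  then show False using no_closable_Berge_path[OF GF p(1,2)] p(4) GX(2) by blast
qed

text \<open>Each of these edges has one vertex in \<open>N\<close> and two in \<open>W\<close>. In
  the core a vertex of degree \<open>d\<close> has \<open>2 * d\<close> neighbours in
  \<open>W\<close> if it lies in \<open>N\<close>, and \<open>d\<close> neighbours on either side if
  it lies in \<open>W\<close>. The thresholds give, by integrality, degree at least
  \<open>l - 2\<close> on \<open>N\<close> and \<open>l - 3\<close> on \<open>W\<close>.\<close>

lemma card_sparse_edges:
  "real (card {f\<in>F. card (f \<inter> N) = 1}) \<le> (real l - 7 / 2) * card W + (real l - 3) * card N"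
proof (rule ccontr)
  let ?F = "{f\<in>F. card (f \<inter> N) = 1}"
  define t where "t v = (if v \<in> N then real l - 3 else real l - 7 / 2)" for v
  have "sum t (N \<union> W) = sum t N + sum t W"
    using finN finW NW_disjoint by (rule sum.union_disjoint)
  also have "sum t N = (\<Sum>v\<in>N. real l - 3)" by (simp add: t_def)
  also have "sum t W = (\<Sum>v\<in>W. real l - 7 / 2)"
    using NW_disjoint by (intro sum.cong refl) (auto simp: t_def)
  finally have tNW: "sum t (N \<union> W) = (real l - 7 / 2) * card W + (real l - 3) * card N" by simp
  assume "\<not> ?thesis"
  then have "sum t (N \<union> W) < (\<Sum>f\<in>?F. 1)" using tNW by simp
  then obtain G X where GX: "G \<subseteq> ?F" "X \<subseteq> N \<union> W" "sum t X < (\<Sum>f\<in>G. 1)"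
    "\<And>f. f \<in> G \<Longrightarrow> f \<inter> (N \<union> W) \<subseteq> X" "\<And>v. v \<in> X \<Longrightarrow> t v < (\<Sum>f\<in>{f\<in>G. v \<in> f}. 1)"
    using exists_dense_core[of "N \<union> W" ?F t "\<lambda>_. 1"] finN finW finF by auto
  have finG: "finite G" and finX: "finite X" and GF: "G \<subseteq> F" and GE: "G \<subseteq> E"
    using GX finF finN finW F_sub by (auto intro: finite_subset)
  define deg where "deg v = card {f\<in>G. v \<in> f}" for v
  have G_edge: "f \<subseteq> X" "card (f \<inter> N) = 1" "card (f \<inter> W) = 2" if f: "f \<in> G" for f
  proof -
    have fNW: "f \<subseteq> N \<union> W" using f GE GF edge[of f] by (auto simp: W_def F_def)
    then show "f \<subseteq> X" using GX(4)[OF f] by auto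
    show N1: "card (f \<inter> N) = 1" using f GX by blast
    have "f = (f \<inter> N) \<union> (f \<inter> W)" using fNW by blast
    then have "card f = card (f \<inter> N) + card (f \<inter> W)"
      using finN finW NW_disjoint card_Un_disjoint[of "f \<inter> N" "f \<inter> W"] by auto
    then show "card (f \<inter> W) = 2" using N1 f GE edge[of f] by auto
  qed
  have NW_nbrs: "card (nbrs G W v) = 2 * deg v" if v: "v \<in> N" for v
  proof -
    have "f \<inter> W - {v} = f \<inter> W" for f using v NW_disjoint by blast
    then have "card (f \<inter> W - {v}) = 2" if "f \<in> G" for f using G_edge[OF that] by simp
    then show ?thesis unfolding card_nbrs[OF GE] deg_def by simp
  qed
  have WW_nbrs: "card (nbrs G W v) = deg v" if v: "v \<in> W" for v
  proof -
    have "card (f \<inter> W - {v}) = 1" if "f \<in> G" "v \<in> f" for f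
      using G_edge[OF that(1)] v that finW by simp
    then show ?thesis unfolding card_nbrs[OF GE] deg_def by simp
  qed
  have WN_nbrs: "card (nbrs G N v) = deg v" if v: "v \<in> W" for v
  proof -
    have "f \<inter> N - {v} = f \<inter> N" for f using v NW_disjoint by blast
    then have "card (f \<inter> N - {v}) = 1" if "f \<in> G" for f using G_edge[OF that] by simp
    then show ?thesis unfolding card_nbrs[OF GE] deg_def by simp
  qed
  have deg_N: "l - 2 \<le> deg v" if "v \<in> X" "v \<in> N" for v
    using GX(5)[OF that(1)] that(2) l5 by (simp add: t_def deg_def)
  have deg_W: "l - 3 \<le> deg v" if "v \<in> X" "v \<in> W" for v
  proof -
    have "real l - 7 / 2 < deg v" using GX(5)[OF that(1)] that(2) NW_disjoint
      by (auto simp: t_def deg_def split: if_splits)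
    then show ?thesis by linarith
  qed
  \<comment> \<open>Degrees over \<open>X \<inter> W\<close> sum to twice the number of core edges,
    so some vertex \<open>a\<close> of \<open>W\<close> has degree above twice the threshold on
    \<open>W\<close>.\<close>
  have "(2 * real l - 7) * card (X \<inter> W) \<le> 2 * sum t X"
  proof -
    have "(\<Sum>v\<in>X \<inter> W. real l - 7 / 2) = sum t (X \<inter> W)"
      using NW_disjoint by (intro sum.cong refl) (auto simp: t_def)
    also have "\<dots> \<le> sum t X" using finX l5 by (intro sum_mono2) (auto simp: t_def)
    finally show ?thesis by (simp add: algebra_simps)
  qed
  also have "\<dots> < (\<Sum>f\<in>G. 1 * real (card (f \<inter> (X \<inter> W))))"
  proof -
    have "f \<inter> (X \<inter> W) = f \<inter> W" if "f \<in> G" for f using G_edge(1)[OF that] by blast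
    then have "(\<Sum>f\<in>G. 1 * real (card (f \<inter> (X \<inter> W)))) = (\<Sum>f\<in>G. 2)"
      using G_edge(3) by (intro sum.cong refl) auto
    then show ?thesis using GX(3) by simp
  qed
  also have "\<dots> = (\<Sum>v\<in>X \<inter> W. real (deg v))"
    using sum_weighted_degree[of "X \<inter> W" G "\<lambda>_. 1"] finX finG by (simp add: deg_def)
  finally obtain a where a: "a \<in> X" "a \<in> W" "2 * real l - 7 < deg a"
    by (rule exists_above_average) auto
  then have big: "2 * l - 6 \<le> deg a" by linarith
  have three: "card f = 3" if "f \<in> G" for f using that GE edge by blast
  have hdX: "y \<in> X" if "Berge_path G (y # zs) (f # es)" for y zs f es
  proof -
    have "f \<in> G" "y \<in> f" using that by (auto simp: Berge_path_def)
    then show ?thesis using G_edge(1) by blast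
  qed
  \<comment> \<open>Two vertices are added per round, first one in \<open>W\<close> and then one in
    \<open>N\<close>, so the parity of the length is preserved and the head returns to
    \<open>N\<close>.\<close>
  have grow: "\<exists>zs es. Berge_path G zs es \<and> length zs = length zs0 + 2 * j \<and> last zs = a \<and>
      hd zs \<in> X \<inter> N \<and> set zs0 \<subseteq> set zs"
    if "Berge_path G zs0 es0" "last zs0 = a" "hd zs0 \<in> X \<inter> N" "length zs0 + 2 * j \<le> l - 2" for zs0 es0 j
    using that(4)
  proof (induction j)
    case 0
    then show ?case using that by auto
  next
    case (Suc j)
    then obtain zs es where p: "Berge_path G zs es" "length zs = length zs0 + 2 * j" "last zs = a"
      "hd zs \<in> X" "hd zs \<in> N" "set zs0 \<subseteq> set zs" by auto
    have nz: "zs \<noteq> []" by (rule Berge_path_nonempty[OF p(1)])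
    have len: "length zs + 2 \<le> l - 2" using p(2) Suc.prems by simp
    have "card (set zs \<inter> W - {hd zs}) + 1 < card (nbrs G W (hd zs))"
      using card_path_minus[of "hd zs" zs W] nz NW_nbrs[OF p(5)] deg_N[OF p(4,5)] len by simp
    then obtain c f where c: "Berge_path G (c # zs) (f # es)" "c \<in> W"
      by (rule Berge_path_step[OF _ p(1) three])
    have "a \<in> set zs" using p(3) nz by auto
    \<comment> \<open>Discounting \<open>a\<close>, which lies in \<open>W\<close>, saves the one
      vertex that the degree bound \<open>l - 3\<close> at \<open>c\<close> cannot spare.\<close>
    have "set (c # zs) \<inter> N - {c} \<subseteq> set zs \<inter> N - {a}" using a(2) NW_disjoint by auto
    then have "card (set (c # zs) \<inter> N - {c}) \<le> card (set zs \<inter> N - {a})"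
      using finN by (intro card_mono) auto
    then have "card (set (c # zs) \<inter> N - {hd (c # zs)}) + 1 < card (nbrs G N (hd (c # zs)))"
      using card_path_minus[OF \<open>a \<in> set zs\<close>, of N] WN_nbrs[OF c(2)] deg_W[OF hdX[OF c(1)] c(2)] len nz
      by (cases zs) auto
    then obtain y g where y: "Berge_path G (y # c # zs) (g # f # es)" "y \<in> N"
      by (rule Berge_path_step[OF _ c(1) three])
    then show ?case using p nz hdX[OF y(1)]
      by (intro exI[of _ "y # c # zs"] exI[of _ "g # f # es"]) auto
  qed
  have pa: "Berge_path G [a] []" by (rule Berge_path_single)
  have a_only: "set [a] \<inter> S - {hd [a]} = {}" for S by auto
  show False
  proof (cases "even l")
    case True
    \<comment> \<open>Closing needs \<open>l - 1 < 2 * l - 6\<close>, that is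
      \<open>l \<ge> 6\<close>.\<close>
    have l6: "6 \<le> l" using True l5 by (cases "l = 5") auto
    have "card (set [a] \<inter> N - {hd [a]}) + 1 < card (nbrs G N (hd [a]))"
      unfolding a_only using WN_nbrs[OF a(2)] big l5 by simp
    then obtain y f where y: "Berge_path G [y, a] [f]" "y \<in> N"
      by (rule Berge_path_step[OF _ pa three])
    have "length [y, a] + 2 * ((l - 4) div 2) = l - 2" using True l6 by auto
    then obtain zs es where p: "Berge_path G zs es" "length zs = l - 2" "last zs = a" "hd zs \<in> N"
      using grow[OF y(1), of "(l - 4) div 2"] y hdX[OF y(1)] by auto
    have "last zs \<in> set zs" using Berge_path_nonempty[OF p(1)] by simp
    then have "card (set zs \<inter> N - {last zs}) \<le> l - 3"
      using card_path_minus[of "last zs" zs N] p(2) by simp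
    then have "card (set zs \<inter> N - {last zs}) + 2 < card (nbrs G N (last zs))"
      using WN_nbrs[OF a(2)] big l6 p(3) by simp
    then show False using no_closable_Berge_path[OF GF p(1,2,4)] by blast
  next
    case False
    have "card (set [a] \<inter> W - {hd [a]}) + 1 < card (nbrs G W (hd [a]))"
      unfolding a_only using WW_nbrs[OF a(2)] big l5 by simp
    then obtain b e where b: "Berge_path G [b, a] [e]" "b \<in> W"
      by (rule Berge_path_step[OF _ pa three])
    have "set [b, a] \<inter> N = {}" using a b NW_disjoint by auto
    then have "card (set [b, a] \<inter> N - {hd [b, a]}) + 1 < card (nbrs G N (hd [b, a]))"
      using WN_nbrs[OF b(2)] deg_W[OF hdX[OF b(1)] b(2)] l5 by simp
    then obtain y f where y: "Berge_path G [y, b, a] [f, e]" "y \<in> N"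
      by (rule Berge_path_step[OF _ b(1) three])
    have "length [y, b, a] + 2 * ((l - 5) div 2) = l - 2" using False l5 by auto
    then obtain zs es where p: "Berge_path G zs es" "length zs = l - 2" "last zs = a" "hd zs \<in> N"
      "b \<in> set zs"
      using grow[OF y(1), of "(l - 5) div 2"] y hdX[OF y(1)] by auto
    have nz: "zs \<noteq> []" by (rule Berge_path_nonempty[OF p(1)])
    have "a \<noteq> b" using b(1) by (auto simp: Berge_path_def)
    \<comment> \<open>Both \<open>a\<close> and \<open>b\<close> lie in \<open>W\<close>, so at most
      \<open>l - 4\<close> path vertices are in \<open>N\<close>. Closing then needs only
      \<open>l - 2 < 2 * l - 6\<close>, which covers \<open>l = 5\<close>.\<close>
    have "set zs \<inter> N - {last zs} \<subseteq> set zs - {a, b}" using b(2) NW_disjoint p(3) by auto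
    then have "card (set zs \<inter> N - {last zs}) \<le> card (set zs - {a, b})" by (intro card_mono) auto
    also have "\<dots> = card (set zs) - card {a, b}"
      using p(3,5) nz by (intro card_Diff_subset) auto
    also have "\<dots> \<le> l - 4" using \<open>a \<noteq> b\<close> p(2) card_length[of zs] by simp
    finally have "card (set zs \<inter> N - {last zs}) + 2 < card (nbrs G N (last zs))"
      using WN_nbrs[OF a(2)] big l5 p(3) by simp
    then show False using no_closable_Berge_path[OF GF p(1,2,4)] by blast
  qed
qed

text \<open>By linearity a vertex of \<open>N\<close> shares just one edge with \<open>u\<close>;
  its other edges lie in \<open>F\<close> and are counted by the two preceding bounds. The size of
  \<open>W\<close> is then eliminated through \<open>card_NW\<close>.\<close>

lemma sum_nbr_degrees:
  "(\<Sum>v\<in>N. real (hdegree E v)) \<le> (real l - 7 / 2) * (real (card V) - 1) + (4 * real l - 6) * hdegree E u"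
proof -
  have deg: "real (hdegree E v) \<le> 1 + (\<Sum>f\<in>{f\<in>F. v \<in> f}. 1)" if vN: "v \<in> N" for v
  proof -
    obtain g where g: "g \<in> E" "u \<in> g" "v \<in> g" using N_edge vN by blast
    have "f = g" if "f \<in> E" "u \<in> f" "v \<in> f" for f
      using linear_hypergraph_unique_edge[OF linear _ that(1) g(1), of u v] that g edge u_notin_N vN
      by blast
    then have "{e\<in>E. v \<in> e} \<subseteq> insert g {f\<in>F. v \<in> f}" by (auto simp: F_def)
    then have "hdegree E v \<le> card (insert g {f\<in>F. v \<in> f})"
      unfolding hdegree_def using finF by (intro card_mono) auto
    also have "\<dots> \<le> Suc (card {f\<in>F. v \<in> f})" by (rule card_insert_le_m1) auto
    finally show ?thesis by simp
  qed
  have "(\<Sum>v\<in>N. real (hdegree E v)) \<le> (\<Sum>v\<in>N. 1 + (\<Sum>f\<in>{f\<in>F. v \<in> f}. 1))"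
    by (rule sum_mono[OF deg])
  also have "\<dots> = card N + (\<Sum>f\<in>F. real (card (f \<inter> N)))"
    unfolding sum.distrib sum_weighted_degree[OF finN finF] by simp
  also have "(\<Sum>f\<in>F. real (card (f \<inter> N))) =
      (\<Sum>f | f \<in> F \<and> 2 \<le> card (f \<inter> N). real (card (f \<inter> N))) + real (card {f\<in>F. card (f \<inter> N) = 1})"
  proof -
    have "(\<Sum>f\<in>F. real (card (f \<inter> N))) = (\<Sum>f\<in>F. (if 2 \<le> card (f \<inter> N) then real (card (f \<inter> N)) else 0) +
        (if card (f \<inter> N) = 1 then 1 else 0))"
      by (intro sum.cong refl) (auto simp: not_le less_2_cases_iff)
    moreover have "real (card {f\<in>F. card (f \<inter> N) = 1}) = (\<Sum>f\<in>F. if card (f \<inter> N) = 1 then 1 else 0)"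
      unfolding sum.inter_filter[OF finF, symmetric] by simp
    ultimately show ?thesis using finF by (simp add: sum.distrib sum.inter_filter)
  qed
  also have "card N + \<dots> \<le> card N + ((2 * real l - 9 / 2) * card N +
      ((real l - 7 / 2) * card W + (real l - 3) * card N))"
    using sum_inter_N_of_dense_edges card_sparse_edges by linarith
  also have "\<dots> = (real l - 7 / 2) * (real (card V) - 1) + (2 * real l - 3) * card N"
    using card_NW by (simp add: algebra_simps)
  also have "\<dots> \<le> (real l - 7 / 2) * (real (card V) - 1) + (2 * real l - 3) * (2 * hdegree E u)"
  proof -
    have "real (card N) \<le> 2 * hdegree E u" using card_nbrs_le[of u] unfolding N_def by linarith
    then show ?thesis using l5 by (intro add_left_mono mult_left_mono) auto
  qed
  finally show ?thesis by (simp add: algebra_simps)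
qed

section \<open>The eigenvalue equation and the spectral bound\<close>

text \<open>Pairs are ordered, as are the tensor indices: each edge at \<open>v\<close> occurs
  twice, matching the entry 1/2 of the adjacency tensor.\<close>

definition edge_pairs :: "'a \<Rightarrow> ('a \<times> 'a) set" where
  "edge_pairs v = {(j, k). j \<in> V \<and> k \<in> V \<and> {v, j, k} \<in> E}"

lemma fin_edge_pairs: "finite (edge_pairs v)"
  by (rule finite_subset[of _ "V \<times> V"]) (auto simp: edge_pairs_def finV)

lemma edge_pairs_distinct:
  assumes "(j, k) \<in> edge_pairs v"
  shows "j \<noteq> v" "k \<noteq> v" "j \<noteq> k"
proof -
  have "card {v, j, k} = 3" using assms edge by (auto simp: edge_pairs_def)
  then show "j \<noteq> v" "k \<noteq> v" "j \<noteq> k" by (auto simp: card_insert_if split: if_splits)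
qed

text \<open>By linearity, \<open>v\<close> and \<open>j\<close> determine the edge, and the edge
  determines its third vertex.\<close>

lemma inj_on_fst_edge_pairs: "inj_on fst (edge_pairs v)"
proof (rule inj_onI)
  fix p q assume p: "p \<in> edge_pairs v" and q: "q \<in> edge_pairs v" and eq: "fst p = fst q"
  obtain j k k' where pq: "p = (j, k)" "q = (j, k')" using eq by (metis prod.collapse)
  have d: "j \<noteq> v" "k \<noteq> v" "j \<noteq> k" "k' \<noteq> v" "j \<noteq> k'"
    using edge_pairs_distinct p q pq by blast+
  have "{v, j, k} = {v, j, k'}"
    using linear_hypergraph_unique_edge[OF linear, of "{v, j, k}" "{v, j, k'}" v j] p q pq d(1)
    by (auto simp: edge_pairs_def)
  then have "k = k'" using d by auto
  then show "p = q" using pq by simp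
qed

lemma fst_edge_pairs_subset: "fst ` edge_pairs v \<subseteq> nbrs E V v"
proof
  fix j assume "j \<in> fst ` edge_pairs v"
  then obtain k where "(j, k) \<in> edge_pairs v" by force
  then show "j \<in> nbrs E V v" using edge_pairs_distinct[of j k v] by (auto simp: edge_pairs_def nbrs_def)
qed

lemma card_edge_pairs_le: "card (edge_pairs v) \<le> 2 * hdegree E v"
proof -
  have "finite (nbrs E V v)" using finV by (simp add: nbrs_def)
  then have "card (edge_pairs v) \<le> card (nbrs E V v)"
    using card_image[OF inj_on_fst_edge_pairs] card_mono[OF _ fst_edge_pairs_subset] by metis
  then show ?thesis using card_nbrs_le[of v] by linarith
qed

text \<open>After AM-GM, swapping the coordinates merges the two halves into the squares of first
  coordinates, each of which is a neighbour of \<open>u\<close> occurring once.\<close>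

lemma sum_edge_pairs_le_sum_squares:
  fixes x :: "'a \<Rightarrow> real"
  shows "(\<Sum>(j, k)\<in>edge_pairs u. x j * x k) \<le> (\<Sum>j\<in>N. (x j)\<^sup>2)"
proof -
  let ?P = "edge_pairs u"
  have "(\<Sum>(j, k)\<in>?P. x j * x k) \<le> (\<Sum>(j, k)\<in>?P. (x j)\<^sup>2 / 2 + (x k)\<^sup>2 / 2)"
  proof (intro sum_mono)
    fix p assume "p \<in> ?P"
    show "(case p of (j, k) \<Rightarrow> x j * x k) \<le> (case p of (j, k) \<Rightarrow> (x j)\<^sup>2 / 2 + (x k)\<^sup>2 / 2)"
      using sum_squares_bound[of "x (fst p)" "x (snd p)"] by (simp add: case_prod_beta)
  qed
  also have "\<dots> = (\<Sum>(j, k)\<in>?P. (x j)\<^sup>2 / 2) + (\<Sum>(j, k)\<in>?P. (x k)\<^sup>2 / 2)"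
    by (simp add: case_prod_beta sum.distrib)
  also have "(\<Sum>(j, k)\<in>?P. (x k)\<^sup>2 / 2) = (\<Sum>(j, k)\<in>?P. (x j)\<^sup>2 / 2)"
    by (rule sum.reindex_bij_witness[of _ prod.swap prod.swap])
      (auto simp: edge_pairs_def insert_commute)
  also have "(\<Sum>(j, k)\<in>?P. (x j)\<^sup>2 / 2) + (\<Sum>(j, k)\<in>?P. (x j)\<^sup>2 / 2) = (\<Sum>p\<in>?P. (x (fst p))\<^sup>2)"
    by (simp add: case_prod_beta flip: sum.distrib)
  also have "\<dots> = (\<Sum>j\<in>fst ` ?P. (x j)\<^sup>2)" by (simp add: sum.reindex[OF inj_on_fst_edge_pairs])
  also have "\<dots> \<le> (\<Sum>j\<in>N. (x j)\<^sup>2)"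
    using fst_edge_pairs_subset[of u] finN by (intro sum_mono2) (auto simp: N_def)
  finally show ?thesis .
qed

lemma Perron_equation:
  assumes x: "alpha_Perron_vector \<alpha> 3 V E x" and v: "v \<in> V"
  shows "rho_alpha \<alpha> 3 V E * (x v)\<^sup>2 =
    \<alpha> * hdegree E v * (x v)\<^sup>2 + (1 - \<alpha>) / 2 * (\<Sum>(j, k)\<in>edge_pairs v. x j * x k)"
proof -
  let ?A = "A_alpha \<alpha> 3 E" and ?d = "real (hdegree E v)"
  let ?y = "\<lambda>v. complex_of_real (x v)"
  \<comment> \<open>This is the real summand for the index pair: the degree tensor contributes only
    at \<open>(v, v)\<close>, the adjacency tensor only on edges.\<close>
  define T where "T = (\<lambda>(j, k). (if j = v \<and> k = v then \<alpha> * ?d * (x v)\<^sup>2 else 0) +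
      (if {v, j, k} \<in> E then (1 - \<alpha>) / 2 * (x j * x k) else 0))"
  have lists: "{is. set is \<subseteq> V \<and> length is = 3 - 1} = (\<lambda>(j, k). [j, k]) ` (V \<times> V)"
    by (auto simp: length_Suc_conv numeral_eq_Suc)
  have inj: "inj_on (\<lambda>(j, k). [j, k]) (V \<times> V)" by (auto simp: inj_on_def)
  have "complex_of_real (rho_alpha \<alpha> 3 V E * (x v)\<^sup>2) =
      (\<Sum>is | set is \<subseteq> V \<and> length is = 3 - 1. ?A (v # is) * prod_list (map ?y is))"
    using x v by (simp add: alpha_Perron_vector_def tensor_eigenpair_def)
  also have "\<dots> = (\<Sum>p\<in>V \<times> V. complex_of_real (T p))"
    unfolding lists sum.reindex[OF inj]
  proof (intro sum.cong refl)
    fix p assume "p \<in> V \<times> V"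
    obtain j k where p: "p = (j, k)" by force
    have "degree_tensor E [v, j, k] = (if j = v \<and> k = v then of_real ?d else 0)"
      by (simp add: degree_tensor_def)
    moreover have "adjacency_tensor 3 E [v, j, k] = (if {v, j, k} \<in> E then of_real (1 / 2) else 0)"
      by (simp add: adjacency_tensor_def fact_numeral)
    ultimately show "((\<lambda>is. ?A (v # is) * prod_list (map ?y is)) \<circ> (\<lambda>(j, k). [j, k])) p = complex_of_real (T p)"
      by (simp add: p T_def A_alpha_def power2_eq_square field_simps)
  qed
  also have "\<dots> = complex_of_real (\<Sum>p\<in>V \<times> V. T p)" by simp
  finally have "rho_alpha \<alpha> 3 V E * (x v)\<^sup>2 = (\<Sum>p\<in>V \<times> V. T p)" using of_real_eq_iff by blast
  also have "\<dots> = (\<Sum>p\<in>V \<times> V. if p = (v, v) then \<alpha> * ?d * (x v)\<^sup>2 else 0) +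
      (\<Sum>p\<in>V \<times> V. if p \<in> edge_pairs v then (1 - \<alpha>) / 2 * (x (fst p) * x (snd p)) else 0)"
    unfolding sum.distrib[symmetric]
    by (intro sum.cong refl) (simp add: T_def edge_pairs_def case_prod_beta mem_Times_iff prod_eq_iff)
  also have "(\<Sum>p\<in>V \<times> V. if p = (v, v) then \<alpha> * ?d * (x v)\<^sup>2 else 0) = \<alpha> * ?d * (x v)\<^sup>2"
    using finV v by simp
  also have "(\<Sum>p\<in>V \<times> V. if p \<in> edge_pairs v then (1 - \<alpha>) / 2 * (x (fst p) * x (snd p)) else 0) =
      (\<Sum>p\<in>(V \<times> V) \<inter> edge_pairs v. (1 - \<alpha>) / 2 * (x (fst p) * x (snd p)))"
    using finV by (intro sum.inter_restrict[symmetric]) simp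
  also have "(V \<times> V) \<inter> edge_pairs v = edge_pairs v" by (auto simp: edge_pairs_def)
  finally show ?thesis by (simp add: sum_distrib_left case_prod_beta)
qed

lemma rho_alpha_bound:
  assumes \<alpha>: "0 \<le> \<alpha>" "\<alpha> < 1" and x: "alpha_Perron_vector \<alpha> 3 V E x"
    and max: "\<And>v. v \<in> V \<Longrightarrow> x v \<le> x u"
  shows "(rho_alpha \<alpha> 3 V E)\<^sup>2 \<le> \<alpha> * (hdegree E u)\<^sup>2 + (1 - \<alpha>) / 2 * (\<Sum>v\<in>N. hdegree E v)"
proof -
  define \<rho> where "\<rho> = rho_alpha \<alpha> 3 V E"
  define P where "P v = (\<Sum>(j, k)\<in>edge_pairs v. x j * x k)" for v
  let ?d = "\<lambda>v. real (hdegree E v)" and ?M = "(x u)\<^sup>2"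
  have pos: "0 < x v" if "v \<in> V" for v using x that by (simp add: alpha_Perron_vector_def)
  have eq: "\<rho> * (x v)\<^sup>2 = \<alpha> * ?d v * (x v)\<^sup>2 + (1 - \<alpha>) / 2 * P v" if "v \<in> V" for v
    using Perron_equation[OF x that] by (simp add: \<rho>_def P_def)
  have M: "0 < ?M" using pos[OF uV] by simp
  have P_nonneg: "0 \<le> P v" for v
    unfolding P_def using pos by (intro sum_nonneg) (auto simp: edge_pairs_def less_imp_le)
  have P_le: "P v \<le> 2 * ?d v * ?M" for v
  proof -
    have "P v \<le> real (card (edge_pairs v)) * ?M"
      unfolding P_def
    proof (intro sum_bounded_above)
      fix p assume "p \<in> edge_pairs v"
      then have "fst p \<in> V" "snd p \<in> V" by (auto simp: edge_pairs_def)
      then have "x (fst p) * x (snd p) \<le> x u * x u"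
        using pos max uV by (intro mult_mono) (auto simp: less_imp_le)
      then show "(case p of (j, k) \<Rightarrow> x j * x k) \<le> ?M" by (simp add: case_prod_beta power2_eq_square)
    qed
    also have "real (card (edge_pairs v)) * ?M \<le> (2 * ?d v) * ?M"
      using card_edge_pairs_le[of v] M by (intro mult_right_mono) linarith+
    finally show ?thesis .
  qed
  have rho_le: "\<rho> * (x v)\<^sup>2 \<le> ?d v * ?M" if v: "v \<in> V" for v
  proof -
    have "(x v)\<^sup>2 \<le> ?M" using pos[OF v] max[OF v] by (intro power_mono) auto
    then have "\<alpha> * ?d v * (x v)\<^sup>2 \<le> \<alpha> * ?d v * ?M" using \<alpha> by (intro mult_left_mono) auto
    moreover have "(1 - \<alpha>) / 2 * P v \<le> (1 - \<alpha>) / 2 * (2 * ?d v * ?M)"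
      using \<alpha> P_le by (intro mult_left_mono) auto
    ultimately have "\<rho> * (x v)\<^sup>2 \<le> \<alpha> * ?d v * ?M + (1 - \<alpha>) / 2 * (2 * ?d v * ?M)"
      using eq[OF v] by linarith
    also have "\<dots> = ?d v * ?M" by (simp add: field_simps)
    finally show ?thesis .
  qed
  \<comment> \<open>Nonnegativity of the supremum \<open>\<rho>\<close> is read off the equation at
    \<open>u\<close>, whose right-hand side is nonnegative.\<close>
  have "0 \<le> \<rho> * ?M" using eq[OF uV] \<alpha> P_nonneg[of u] by simp
  then have rho0: "0 \<le> \<rho>" using M by (simp add: zero_le_mult_iff)
  \<comment> \<open>The local estimate at \<open>u\<close> itself later turns
    \<open>\<alpha> * d u * \<rho>\<close> into \<open>\<alpha> * (d u)^2\<close>.\<close>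
  have rho_d: "\<rho> \<le> ?d u" using rho_le[OF uV] M by simp
  have "\<rho> * P u \<le> \<rho> * (\<Sum>j\<in>N. (x j)\<^sup>2)"
    using sum_edge_pairs_le_sum_squares rho0 unfolding P_def by (intro mult_left_mono) auto
  also have "\<dots> = (\<Sum>j\<in>N. \<rho> * (x j)\<^sup>2)" by (rule sum_distrib_left)
  also have "\<dots> \<le> (\<Sum>j\<in>N. ?d j * ?M)" using rho_le N_sub by (intro sum_mono) auto
  also have "\<dots> = (\<Sum>j\<in>N. ?d j) * ?M" by (rule sum_distrib_right[symmetric])
  finally have "(1 - \<alpha>) / 2 * (\<rho> * P u) \<le> (1 - \<alpha>) / 2 * ((\<Sum>j\<in>N. ?d j) * ?M)"
    using \<alpha> by (intro mult_left_mono) auto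
  moreover have "\<rho>\<^sup>2 * ?M = \<alpha> * ?d u * ?M * \<rho> + (1 - \<alpha>) / 2 * (\<rho> * P u)"
  proof -
    have "\<rho>\<^sup>2 * ?M = \<rho> * (\<rho> * ?M)" by (simp add: power2_eq_square)
    then show ?thesis unfolding eq[OF uV] by (simp add: algebra_simps)
  qed
  moreover have "\<alpha> * ?d u * ?M * \<rho> \<le> \<alpha> * ?d u * ?M * ?d u"
    using rho_d \<alpha> by (intro mult_left_mono) auto
  ultimately have "\<rho>\<^sup>2 * ?M \<le> \<alpha> * ?d u * ?M * ?d u + (1 - \<alpha>) / 2 * ((\<Sum>j\<in>N. ?d j) * ?M)"
    by linarith
  also have "\<dots> = (\<alpha> * (?d u)\<^sup>2 + (1 - \<alpha>) / 2 * (\<Sum>v\<in>N. ?d v)) * ?M"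
    by (simp add: algebra_simps power2_eq_square)
  finally have "\<rho>\<^sup>2 \<le> \<alpha> * (?d u)\<^sup>2 + (1 - \<alpha>) / 2 * (\<Sum>v\<in>N. ?d v)"
    using M by (rule mult_right_le_imp_le)
  then show ?thesis by (simp add: \<rho>_def)
qed

end

theorem theorem3p1:
  fixes V :: "'a set" and E :: "'a set set" and n l :: nat and \<alpha> :: real
    and x :: "'a \<Rightarrow> real" and u :: 'a
  assumes "n \<ge> 3" and "l \<ge> 5" and "0 \<le> \<alpha>" and "\<alpha> < 1"
    and "k_graph 3 V E" and "card V = n"
    and "hconnected V E" and "linear_hypergraph E"
    and "Berge_free {..<l} (cycle_edges l) V E"
    and "alpha_Perron_vector \<alpha> 3 V E x"
    and "u \<in> V" and "\<And>v. v \<in> V \<Longrightarrow> x v \<le> x u"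
  shows "(rho_alpha \<alpha> 3 V E)\<^sup>2 \<le>
    \<alpha> * (real (hdegree E u))\<^sup>2 +
    (1 - \<alpha>) * ((2 * real l - 7) * (real n - 1) / 4 + (2 * real l - 3) * real (hdegree E u))"
proof -
  interpret Berge_cycle_free_linear_3graph V E l u
    using assms by unfold_locales auto
  let ?D = "\<Sum>v\<in>N. real (hdegree E v)"
  have "(rho_alpha \<alpha> 3 V E)\<^sup>2 \<le> \<alpha> * (real (hdegree E u))\<^sup>2 + (1 - \<alpha>) / 2 * ?D"
    using rho_alpha_bound[OF assms(3,4,10,12)] by simp
  also have "(1 - \<alpha>) / 2 * ?D \<le> (1 - \<alpha>) / 2 *
      ((real l - 7 / 2) * (real n - 1) + (4 * real l - 6) * hdegree E u)"
    using sum_nbr_degrees assms(4,6) by (intro mult_left_mono) auto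
  also have "\<dots> = (1 - \<alpha>) * ((2 * real l - 7) * (real n - 1) / 4 + (2 * real l - 3) * real (hdegree E u))"
    by (simp add: field_simps)
  finally show ?thesis by simp
qed

end
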